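(* Let $h\ge 2$, let $T_h$ be the complete binary tree of height $h$, and let $\ell$ be a leaf of $T_h$ (a vertex at distance $h$ from the root). Let $T_h-\ell$ denote the tree obtained by deleting $\ell$. Then $$\gamma(T_h-\ell)=\gamma(T_h),\qquad \zeta(T_h-\ell)=2\,\zeta(T_h).$$
   Context: The complete binary tree $T_h$ of height $h$ is the rooted tree in which every vertex at distance less than $h$ from the root has exactly two children and the vertices at distance $h$ from the root are leaves. It is regarded as a finite simple (undirected) graph. For a finite simple graph $G$, a set $D\subseteq V(G)$ is dominating if every vertex of $G$ lies in $D$ or has a neighbor in $D$. The domination number $\gamma(G)$ is the minimum size of a dominating set. The dominion $\zeta(G)$ is the number of dominating sets of $G$ of size $\gamma(G)$. *)

theory Defs
  imports "Graph_Theory.Graph_Theory"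
begin

text \<open>
  Finite simple undirected graphs are the symmetric, loop-free digraphs without parallel arcs of
  the locale \<^locale>\<open>graph\<close>.  The library abbreviation \<^term>\<open>dominates G u v\<close>,
  written \<open>u \<rightarrow>\<^bsub>G\<^esub> v\<close>, is adjacency and is unrelated to domination in the sense below.
\<close>

definition dominating_set :: "('a, 'b) pre_digraph \<Rightarrow> 'a set \<Rightarrow> bool" where
  "dominating_set G D \<longleftrightarrow> D \<subseteq> verts G \<and> (\<forall>v \<in> verts G. v \<in> D \<or> (\<exists>u \<in> D. v \<rightarrow>\<^bsub>G\<^esub> u))"

definition domination_number :: "('a, 'b) pre_digraph \<Rightarrow> nat" where
  "domination_number G = Min (card ` {D. dominating_set G D})"

definition dominion :: "('a, 'b) pre_digraph \<Rightarrow> nat" where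
  "dominion G = card {D. dominating_set G D \<and> card D = domination_number G}"

definition distance :: "('a, 'b) pre_digraph \<Rightarrow> 'a \<Rightarrow> 'a \<Rightarrow> ereal" where
  "distance G u v = wf_digraph.\<mu> G (\<lambda>_. 1) u v"

text \<open>
  The library predicate \<^const>\<open>tree\<close> cannot be used for undirected graphs: it counts an edge
  traversed back and forth as a cycle.  Since the vertices of a \<^const>\<open>pre_digraph.cycle\<close>
  are pairwise distinct, those of length at least 3 are exactly the undirected cycles.
\<close>

locale tree_graph = graph +
  assumes connected: "connected G"
    and acyclic: "\<not> (\<exists>p. cycle p \<and> 3 \<le> length p)"

definition children :: "('a, 'b) pre_digraph \<Rightarrow> 'a \<Rightarrow> 'a \<Rightarrow> 'a set" where
  "children T r v = {w \<in> verts T. v \<rightarrow>\<^bsub>T\<^esub> w \<and> distance T r w = distance T r v + 1}"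

locale complete_binary_tree = tree_graph T for T :: "('a, 'b) pre_digraph" +
  fixes r :: 'a and h :: nat
  assumes root: "r \<in> verts T"
    and two_children:
      "\<And>v. \<lbrakk>v \<in> verts T; distance T r v < ereal (real h)\<rbrakk> \<Longrightarrow> card (children T r v) = 2"
    and leaves:
      "\<And>v. \<lbrakk>v \<in> verts T; distance T r v = ereal (real h)\<rbrakk> \<Longrightarrow> children T r v = {}"

text \<open>
  A model for every height: vertices are the words of length at most \<open>h\<close>, and the parent of a
  nonempty word is its tail.
\<close>

definition word_tree :: "nat \<Rightarrow> bool list pair_pre_digraph" where
  "word_tree h = \<lparr>pverts = {v. length v \<le> h},
     parcs = {(u, v). length u \<le> h \<and> length v \<le> h \<and> (\<exists>b. u = b # v \<or> v = b # u)}\<rparr>"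

lemma word_tree_simps [simp]:
  "v \<in> pverts (word_tree h) \<longleftrightarrow> length v \<le> h"
  "(u, v) \<in> parcs (word_tree h) \<longleftrightarrow>
    length u \<le> h \<and> length v \<le> h \<and> (\<exists>b. u = b # v \<or> v = b # u)"
  by (auto simp: word_tree_def)

lemma graph_word_tree: "pair_graph (word_tree h)"
proof -
  have fin: "finite {v::bool list. length v \<le> h}"
    using finite_lists_length_le[of "UNIV::bool set" h] by simp
  have "parcs (word_tree h) \<subseteq> {v. length v \<le> h} \<times> {v. length v \<le> h}"
    by (auto simp: word_tree_def)
  then have "finite (parcs (word_tree h))"
    using fin finite_subset by blast
  then show ?thesis
    using fin by unfold_locales (auto simp: word_tree_def symmetric_def sym_def)
qed

lemma distance_word_tree:
  assumes "length v \<le> h"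
  shows "distance (word_tree h) [] v = ereal (real (length v))"
proof -
  interpret pair_graph "word_tree h" by (rule graph_word_tree)
  have cost: "awalk_cost (\<lambda>_. 1) p = real (length p)" for p :: "(bool list \<times> bool list) list"
    by (induction p) (auto simp: awalk_cost_def)
  have up: "\<exists>p. awalk [] p v \<and> length p = length v" using assms
  proof (induction v)
    case Nil then show ?case by (auto simp: awalk_Nil_iff)
  next
    case (Cons b v)
    then obtain p where "awalk [] p v" "length p = length v" by auto
    moreover have "awalk v [(v, b # v)] (b # v)" using Cons.prems
      by (auto simp: awalk_simps)
    ultimately show ?case
      by (intro exI[of _ "p @ [(v, b # v)]"]) (auto simp: awalk_appendI)
  qed
  have low: "length v \<le> length u + length p" if "awalk u p v" for u p v
    using that by (induction p arbitrary: u) (fastforce simp: awalk_Cons_iff awalk_Nil_iff)+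
  have "\<mu> (\<lambda>_. 1) [] v = ereal (real (length v))"
    unfolding \<mu>_def cost using up low[of "[]" _ v]
    by (intro antisym INF_greatest) (auto intro: INF_lower2)
  then show ?thesis by (simp add: distance_def)
qed

lemma awalk_nth:
  assumes "pair_wf_digraph G" "pre_digraph.awalk (with_proj G) u p v" "i < length p"
  shows "p ! i = (pawalk_verts u p ! i, pawalk_verts u p ! Suc i)" "p ! i \<in> parcs G"
proof -
  interpret pair_wf_digraph G by fact
  have "p ! i = (pawalk_verts u p ! i, pawalk_verts u p ! Suc i) \<and> p ! i \<in> parcs G"
    using assms(2,3)
  proof (induction p arbitrary: u i)
    case (Cons e p)
    then show ?case
      by (cases i; cases p; cases e) (auto simp: awalk_Cons_iff)
  qed simp
  then show "p ! i = (pawalk_verts u p ! i, pawalk_verts u p ! Suc i)" "p ! i \<in> parcs G" by auto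
qed

lemma length_pawalk_verts: "length (pawalk_verts u p) = Suc (length p)"
  by (induction p arbitrary: u) auto

lemma complete_binary_tree_word_tree: "complete_binary_tree (word_tree h) [] h"
proof -
  interpret pair_graph "word_tree h" by (rule graph_word_tree)
  have "connected (word_tree h)"
  proof -
    have r: "[] \<rightarrow>\<^sup>*\<^bsub>word_tree h\<^esub> v" if "length v \<le> h" for v
      using that distance_word_tree[OF that] \<mu>_reach_conv[of "\<lambda>_. 1" "[]" v] by (simp add: distance_def)
    then have "u \<rightarrow>\<^sup>*\<^bsub>word_tree h\<^esub> v" if "length u \<le> h" "length v \<le> h" for u v
      using that symmetric_reachable[OF sym_arcs] reachable_trans by meson
    moreover have "[] \<in> pverts (word_tree h)" by simp
    then have "pverts (word_tree h) \<noteq> {}" by blast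
    ultimately show ?thesis
      unfolding connected_def strongly_connected_def
      by (auto simp: reachable_mk_symmetric_eq[OF sym_arcs] simp del: word_tree_simps(2))
  qed
  moreover have "\<not> (\<exists>p. cycle p \<and> 3 \<le> length p)"
  proof
    assume "\<exists>p. cycle p \<and> 3 \<le> length p"
    then obtain u p where p: "awalk u p u" "distinct (tl (pawalk_verts u p))" "3 \<le> length p"
      unfolding cycle_def by auto
    define x where "x i = pawalk_verts u p ! i" for i
    define n where "n = length p"
    have len: "length (pawalk_verts u p) = Suc n"
      unfolding n_def by (rule length_pawalk_verts)
    have x0: "x 0 = u" unfolding x_def by (cases p) (use p in auto)
    have "last (pawalk_verts u p) = u" using awlast_of_awalk[OF p(1)] by simp
    moreover have "pawalk_verts u p \<noteq> []" using len by auto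
    ultimately have xn: "x n = u" using len last_conv_nth[of "pawalk_verts u p"] by (simp add: x_def)
    have arc: "(x i, x (Suc i)) \<in> parcs (word_tree h)" if "i < n" for i
      using awalk_nth[OF _ p(1)] that pair_wf_digraph unfolding n_def x_def by metis
    have inj: "i = j" if "x i = x j" "1 \<le> i" "i \<le> n" "1 \<le> j" "j \<le> n" for i j
      using nth_eq_iff_index_eq[OF p(2), of "i - 1" "j - 1"] that len
      by (auto simp: x_def nth_tl)
    have n3: "3 \<le> n" using p(3) n_def by simp
    have "Max ((\<lambda>i. length (x i)) ` {1..n}) \<in> (\<lambda>i. length (x i)) ` {1..n}"
      using n3 by (intro Max_in) auto
    then obtain i where i: "i \<in> {1..n}" and "Max ((\<lambda>i. length (x i)) ` {1..n}) = length (x i)"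
      by blast
    then have mx: "length (x j) \<le> length (x i)" if "j \<in> {1..n}" for j
      using that by (metis Max_ge finite_atLeastAtMost finite_imageI imageI)
    define a where "a = (if i = 1 then n else i - 1)"
    define c where "c = (if i = n then 1 else i + 1)"
    have ac: "a \<in> {1..n}" "c \<in> {1..n}" "a \<noteq> c" using i n3 by (auto simp: a_def c_def split: if_splits)
    have "(x a, x i) \<in> parcs (word_tree h)"
      using arc[of "i - 1"] i x0 xn by (auto simp: a_def split: if_splits)
    moreover have "(x i, x c) \<in> parcs (word_tree h)"
      using arc[of i] arc[of 0] i x0 xn n3 by (auto simp: c_def split: if_splits)
    ultimately have "x a = tl (x i)" "x c = tl (x i)"
      using mx[OF ac(1)] mx[OF ac(2)] by auto
    then show False using inj[of a c] ac by auto
  qed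
  moreover have "children (word_tree h) [] v = (\<lambda>b. b # v) ` {b. length v < h}" if "length v \<le> h" for v
    using that distance_word_tree[of _ h] by (auto simp: children_def distance_word_tree)
  moreover have "card ((\<lambda>b::bool. b # v) ` UNIV) = 2" for v
    by (subst card_image) (auto simp: inj_on_def card_UNIV_bool)
  ultimately show ?thesis
    by unfold_locales (auto simp: distance_word_tree)
qed

end

theory Submission
  imports Defs
begin

text \<open>
  Let \<open>p\<close> be the parent of \<open>l\<close>, \<open>l'\<close> the sibling of \<open>l\<close>, and \<open>p'\<close> the sibling of \<open>p\<close>.  A vertex with
  two leaf neighbours lies in every minimum dominating set and those leaves do not, since otherwise
  a smaller dominating set could be formed.  Hence every minimum dominating set \<open>D\<close> of \<open>T\<close> contains
  \<open>p\<close> and \<open>p'\<close>, and both \<open>D\<close> and \<open>D - {p} \<union> {l'}\<close> dominate \<open>T - l\<close>: in the latter, the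
  parent of \<open>p\<close> is still dominated by \<open>p'\<close>.  Conversely, a minimum dominating set of \<open>T - l\<close> contains
  \<open>p\<close> or \<open>l'\<close>, and exchanging \<open>l'\<close> for \<open>p\<close> in the second case gives a dominating set of \<open>T\<close>.
\<close>

section \<open>Minimum dominating sets\<close>

definition min_dominating_set :: "('a, 'b) pre_digraph \<Rightarrow> 'a set \<Rightarrow> bool" where
  "min_dominating_set G D \<longleftrightarrow> dominating_set G D \<and> card D = domination_number G"

lemma dominion_conv: "dominion G = card {D. min_dominating_set G D}"
  by (simp add: dominion_def min_dominating_set_def)

context fin_digraph
begin

lemma finite_dominating_sets: "finite {D. dominating_set G D}"
  by (rule finite_subset[of _ "Pow (verts G)"]) (auto simp: dominating_set_def)

lemma finite_dominating_set: "dominating_set G D \<Longrightarrow> finite D"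
  by (auto simp: dominating_set_def intro: finite_subset)

lemma domination_number_le: "dominating_set G D \<Longrightarrow> domination_number G \<le> card D"
  unfolding domination_number_def by (rule Min_le) (auto simp: finite_dominating_sets)

lemma ex_min_dominating_set: "\<exists>D. min_dominating_set G D"
proof -
  have "dominating_set G (verts G)" by (auto simp: dominating_set_def)
  then have "domination_number G \<in> card ` {D. dominating_set G D}"
    unfolding domination_number_def by (intro Min_in) (auto simp: finite_dominating_sets)
  then show ?thesis by (auto simp: min_dominating_set_def)
qed

end

section \<open>Domination after deleting a vertex\<close>

lemma dominates_del_vert_iff:
  "u \<rightarrow>\<^bsub>pre_digraph.del_vert G w\<^esub> v \<longleftrightarrow> u \<rightarrow>\<^bsub>G\<^esub> v \<and> u \<noteq> w \<and> v \<noteq> w"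
  by (auto simp: arcs_ends_def arc_to_ends_def pre_digraph.del_vert_def)

text \<open>Since \<open>D\<close> avoids \<open>w\<close>, adjacency in \<open>G\<close> can be
  used on both sides, so dominating sets of the two graphs are compared through one
  relation.\<close>

lemma dominating_set_del_vert_iff:
  "dominating_set (pre_digraph.del_vert G w) D \<longleftrightarrow>
    D \<subseteq> verts G - {w} \<and> (\<forall>v \<in> verts G - {w}. v \<in> D \<or> (\<exists>u \<in> D. v \<rightarrow>\<^bsub>G\<^esub> u))"
proof -
  have "verts (pre_digraph.del_vert G w) = verts G - {w}"
    by (simp add: pre_digraph.del_vert_def)
  then show ?thesis by (auto simp: dominating_set_def dominates_del_vert_iff)
qed

section \<open>Leaves and twin leaves\<close>

context graph
begin

lemma dominates_sym: "u \<rightarrow> v \<Longrightarrow> v \<rightarrow> u"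
  using arcs_ends_symmetric[OF sym_arcs] by blast

lemma dominates_neq: "u \<rightarrow> v \<Longrightarrow> u \<noteq> v"
  using adj_not_same by blast

lemma dominates_in_verts: "u \<rightarrow> v \<Longrightarrow> u \<in> verts G" "u \<rightarrow> v \<Longrightarrow> v \<in> verts G"
  by (auto simp: adj_in_verts)

definition leaf_of :: "'a \<Rightarrow> 'a \<Rightarrow> bool" where
  "leaf_of l p \<longleftrightarrow> (\<forall>u. l \<rightarrow> u \<longleftrightarrow> u = p)"

lemma leaf_of_nbr: "leaf_of l p \<Longrightarrow> v \<rightarrow> l \<Longrightarrow> v = p"
  using dominates_sym by (auto simp: leaf_of_def)

lemma leaf_of_dominates: "leaf_of l p \<Longrightarrow> l \<rightarrow> p" "leaf_of l p \<Longrightarrow> p \<rightarrow> l"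
  using dominates_sym by (auto simp: leaf_of_def)

lemma leaf_of_dominating_set:
  assumes "leaf_of l p" "dominating_set G D"
  shows "l \<in> D \<or> p \<in> D"
  using assms dominates_in_verts[of l p] by (auto simp: dominating_set_def leaf_of_def)

text \<open>If \<open>p\<close> were missing, both leaves would have to be in \<open>D\<close>, and
  replacing the two by \<open>p\<close> would save a vertex. Once \<open>p\<close> is present, a
  leaf in \<open>D\<close> dominates only itself and \<open>p\<close>, both of which
  \<open>p\<close> dominates, so it could be dropped.\<close>

lemma min_dominating_set_twin_leaves:
  assumes D: "min_dominating_set G D" and l: "leaf_of l p" and l': "leaf_of l' p" and "l \<noteq> l'"
  shows "p \<in> D" "l \<notin> D"
proof -
  have dom: "dominating_set G D" and fin: "finite D"
    and small: "\<And>E. dominating_set G E \<Longrightarrow> card D \<le> card E"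
    using D finite_dominating_set domination_number_le by (auto simp: min_dominating_set_def)
  show p: "p \<in> D"
  proof (rule ccontr)
    assume "p \<notin> D"
    then have in_D: "l \<in> D" "l' \<in> D" using l l' dom leaf_of_dominating_set by blast+
    have "v \<in> insert p (D - {l, l'}) \<or> (\<exists>u \<in> insert p (D - {l, l'}). v \<rightarrow> u)"
      if "v \<in> verts G" for v
    proof (cases "v \<in> {p, l, l'}")
      case True
      then show ?thesis using leaf_of_dominates l l' by blast
    next
      case False
      then have "\<not> v \<rightarrow> l" "\<not> v \<rightarrow> l'" using leaf_of_nbr l l' by blast+
      then show ?thesis using dom that False by (auto simp: dominating_set_def)
    qed
    moreover have "p \<in> verts G" using leaf_of_dominates(1)[OF l] dominates_in_verts by blast
    ultimately have "dominating_set G (insert p (D - {l, l'}))"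
      using dom by (auto simp: dominating_set_def)
    then have "card D \<le> card (insert p (D - {l, l'}))" by (rule small)
    also have "\<dots> \<le> Suc (card (D - {l, l'}))" by (rule card_insert_le_m1) auto
    also have "card (D - {l, l'}) = card D - 2"
      using in_D \<open>l \<noteq> l'\<close> fin by (subst card_Diff_subset) auto
    \<comment> \<open>With truncated subtraction, \<open>card D \<le> Suc (card D - 2)\<close> is
      possible only below 2, which contradicts the two leaves in \<open>D\<close>.\<close>
    finally have "card D < 2" by linarith
    moreover have "card {l, l'} \<le> card D" using in_D fin by (intro card_mono) auto
    ultimately show False using \<open>l \<noteq> l'\<close> by simp
  qed
  show "l \<notin> D"
  proof
    assume "l \<in> D"
    have "p \<noteq> l" using dominates_neq leaf_of_dominates[OF l] by blast
    have "v \<in> D - {l} \<or> (\<exists>u \<in> D - {l}. v \<rightarrow> u)" if "v \<in> verts G" for v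
    proof (cases "v \<in> {p, l}")
      case True
      then show ?thesis using leaf_of_dominates(1)[OF l] p \<open>p \<noteq> l\<close> by blast
    next
      case False
      then have "\<not> v \<rightarrow> l" using leaf_of_nbr[OF l] by blast
      then show ?thesis using dom that False by (auto simp: dominating_set_def)
    qed
    then have "dominating_set G (D - {l})"
      using dom by (auto simp: dominating_set_def)
    then show False using small \<open>l \<in> D\<close> fin by (metis card_Diff1_less not_le)
  qed
qed

text \<open>Only this configuration around \<open>l\<close> matters, so no tree structure is
  assumed. The twin leaves \<open>m\<close> and \<open>m'\<close> force \<open>p'\<close> into every
  minimum dominating set, which keeps \<open>q\<close> dominated when \<open>p\<close> is given up.
  The maps \<open>push\<close> and \<open>pull\<close> match the minimum dominating sets of
  \<open>G\<close> with those of \<open>del_vert l\<close> that avoid \<open>p\<close>.\<close>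

lemma domination_del_twin_leaf:
  assumes l: "leaf_of l p" and l': "leaf_of l' p" and "l \<noteq> l'"
    and nbrs: "\<And>u. p \<rightarrow> u \<Longrightarrow> u \<in> {l, l', q}"
    and q: "q \<rightarrow> p'" "p' \<noteq> p"
    and m: "leaf_of m p'" and m': "leaf_of m' p'" and "m \<noteq> m'"
  shows "domination_number (del_vert l) = domination_number G"
    and "dominion (del_vert l) = 2 * dominion G"
proof -
  interpret H: fin_digraph "del_vert l" by (rule fin_digraph_del_vert)
  define M where "M = {D. min_dominating_set G D}"
  define push where "push D = insert l' (D - {p})" for D
  define pull where "pull D = insert p (D - {l'})" for D
  have adj: "l \<rightarrow> p" "p \<rightarrow> l" "l' \<rightarrow> p" "p \<rightarrow> l'"
    using leaf_of_dominates l l' by blast+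
  have neq: "p \<noteq> l" "p \<noteq> l'" using adj dominates_neq by blast+
  note vin = dominates_in_verts[OF adj(2)] dominates_in_verts[OF adj(4)]
  have M_in: "p \<in> D" "l \<notin> D" "l' \<notin> D" "p' \<in> D" "finite D" "dominating_set G D"
    "card D = domination_number G" if "D \<in> M" for D
    using that min_dominating_set_twin_leaves[OF _ l l' \<open>l \<noteq> l'\<close>]
      min_dominating_set_twin_leaves[OF _ l' l \<open>l \<noteq> l'\<close>[symmetric]]
      min_dominating_set_twin_leaves[OF _ m m' \<open>m \<noteq> m'\<close>] finite_dominating_set
    by (auto simp: M_def min_dominating_set_def)
  have keep: "dominating_set (del_vert l) D" if "D \<in> M" for D
    using M_in(2,6)[OF that] unfolding dominating_set_del_vert_iff by (auto simp: dominating_set_def)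
  \<comment> \<open>The only additional vertex to dominate is \<open>l\<close>, and its neighbour
    \<open>p\<close> is in \<open>D\<close>.\<close>
  have keep': "dominating_set G D" if "dominating_set (del_vert l) D" "p \<in> D" for D
    using that adj(1) unfolding dominating_set_del_vert_iff by (auto simp: dominating_set_def)
  have push: "dominating_set (del_vert l) (push D)" if "D \<in> M" for D
  proof -
    \<comment> \<open>Removing \<open>p\<close> can affect only \<open>p\<close> and its neighbours:
      \<open>l\<close> is deleted, \<open>l'\<close> takes care of itself and \<open>p\<close>, and
      \<open>p'\<close> dominates \<open>q\<close>.\<close>
    have "v \<in> push D \<or> (\<exists>u \<in> push D. v \<rightarrow> u)" if v: "v \<in> verts G - {l}" for v
    proof (cases "v \<in> {p, l', q}")
      case True
      then show ?thesis using adj q M_in(4)[OF \<open>D \<in> M\<close>] by (auto simp: push_def)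
    next
      case False
      then have "\<not> v \<rightarrow> p" using nbrs[of v] dominates_sym v by auto
      then show ?thesis using M_in(6)[OF \<open>D \<in> M\<close>] v False
        by (auto simp: dominating_set_def push_def)
    qed
    moreover have "push D \<subseteq> verts G - {l}"
      using M_in(2,6)[OF that] vin \<open>l \<noteq> l'\<close> by (auto simp: push_def dominating_set_def)
    ultimately show ?thesis unfolding dominating_set_del_vert_iff by blast
  qed
  have card_push: "card (push D) = domination_number G" if "D \<in> M" for D
    using M_in(1,3,5,7)[OF that] card_Suc_Diff1[of D p] by (simp add: push_def)
  \<comment> \<open>The leaf \<open>l'\<close> survives the deletion, and apart from itself only
    \<open>p\<close> could dominate it.\<close>
  have l'_in: "l' \<in> D" if "dominating_set (del_vert l) D" "p \<notin> D" for D
    using that l' vin(4) \<open>l \<noteq> l'\<close> unfolding dominating_set_del_vert_iff leaf_of_def by fastforce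
  have pull: "dominating_set G (pull D)" "card (pull D) = card D" "push (pull D) = D"
    if D: "dominating_set (del_vert l) D" "p \<notin> D" for D
  proof -
    \<comment> \<open>Removing \<open>l'\<close> can affect only \<open>l'\<close> and
      \<open>p\<close>, and \<open>l\<close> is the one vertex added back; \<open>p\<close>
      dominates all three.\<close>
    have "v \<in> pull D \<or> (\<exists>u \<in> pull D. v \<rightarrow> u)" if v: "v \<in> verts G" for v
    proof (cases "v \<in> {p, l, l'}")
      case True
      then show ?thesis using adj by (auto simp: pull_def)
    next
      case False
      then have "\<not> v \<rightarrow> l'" using leaf_of_nbr[OF l'] by blast
      then show ?thesis using D(1) v False
        unfolding dominating_set_del_vert_iff by (auto simp: pull_def)
    qed
    then show "dominating_set G (pull D)"
      using D(1) vin unfolding dominating_set_del_vert_iff by (auto simp: dominating_set_def pull_def)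
    show "card (pull D) = card D"
      using D(2) l'_in[OF D] H.finite_dominating_set[OF D(1)] card_Suc_Diff1[of D l']
      by (simp add: pull_def)
    show "push (pull D) = D" using D l'_in[OF D] unfolding push_def pull_def by blast
  qed
  show num: "domination_number (del_vert l) = domination_number G"
  proof (rule antisym)
    obtain D where D: "D \<in> M" using ex_min_dominating_set by (auto simp: M_def)
    show "domination_number (del_vert l) \<le> domination_number G"
      using H.domination_number_le[OF keep[OF D]] M_in[OF D] by simp
    obtain D where "min_dominating_set (del_vert l) D" using H.ex_min_dominating_set by blast
    then have D: "dominating_set (del_vert l) D" "card D = domination_number (del_vert l)"
      by (auto simp: min_dominating_set_def)
    \<comment> \<open>A minimum dominating set of \<open>del_vert l\<close> dominates
      \<open>G\<close> if it contains \<open>p\<close>; otherwise \<open>pull\<close> yields one of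
      equal size that does.\<close>
    show "domination_number G \<le> domination_number (del_vert l)"
      using domination_number_le keep'[OF D(1)] pull[OF D(1)] D(2) by metis
  qed
  have "{D. min_dominating_set (del_vert l) D} = M \<union> push ` M"
  proof (intro equalityI subsetI)
    fix D assume "D \<in> {D. min_dominating_set (del_vert l) D}"
    then have D: "dominating_set (del_vert l) D" "card D = domination_number G"
      by (auto simp: min_dominating_set_def num)
    show "D \<in> M \<union> push ` M"
    proof (cases "p \<in> D")
      case True
      then show ?thesis using keep' D by (simp add: M_def min_dominating_set_def)
    next
      case False
      then have "pull D \<in> M" using pull D by (simp add: M_def min_dominating_set_def)
      then show ?thesis using pull(3)[OF D(1) False] by (metis UnI2 imageI)
    qed
  next
    fix D assume "D \<in> M \<union> push ` M"
    then show "D \<in> {D. min_dominating_set (del_vert l) D}"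
      using keep push card_push M_in(7) by (auto simp: min_dominating_set_def num)
  qed
  moreover have "inj_on push M"
  proof (rule inj_on_inverseI)
    show "pull (push D) = D" if "D \<in> M" for D
      using M_in[OF that] by (auto simp: push_def pull_def)
  qed
  \<comment> \<open>Every member of \<open>M\<close> contains \<open>p\<close>, while
    \<open>push\<close> removes it and inserts \<open>l' \<noteq> p\<close>.\<close>
  moreover have "M \<inter> push ` M = {}" using M_in neq by (auto simp: push_def)
  moreover have "finite M"
    using finite_dominating_sets by (rule rev_finite_subset) (auto simp: M_def min_dominating_set_def)
  ultimately have "dominion (del_vert l) = card M + card M"
    by (simp add: dominion_conv card_Un_disjoint card_image)
  then show "dominion (del_vert l) = 2 * dominion G"
    by (simp add: dominion_conv M_def)
qed

end

section \<open>Depth in a tree\<close>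

text \<open>Each arc is replaced by its opposite, so the arcs change and only the vertex set is
  tracked. This later joins two walks that both end in the root.\<close>

lemma (in graph) awalk_reverse:
  assumes "awalk u p v"
  shows "\<exists>q. awalk v q u \<and> set (awalk_verts v q) = set (awalk_verts u p)"
  using assms
proof (induction p arbitrary: u)
  case Nil
  then show ?case by (intro exI[of _ "[]"]) (auto simp: awalk_Nil_iff)
next
  case (Cons e p)
  then have e: "e \<in> arcs G" "tail G e = u" "awalk (head G e) p v" by (auto simp: awalk_simps)
  obtain q where q: "awalk v q (head G e)" "set (awalk_verts v q) = set (awalk_verts (head G e) p)"
    using Cons.IH[OF e(3)] by blast
  have "u \<rightarrow> head G e" using e by (auto simp: arcs_ends_conv)
  then obtain f where f: "f \<in> arcs G" "tail G f = head G e" "head G f = u"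
    using dominates_sym by (fastforce simp: arcs_ends_conv)
  then have "awalk (head G e) [f] u" by (auto simp: awalk_simps)
  then show ?case using q e f set_awalk_verts_append[OF q(1), of "[f]" u] hd_in_awalk_verts(1)[OF e(3)]
    by (intro exI[of _ "q @ [f]"]) auto
qed

context tree_graph
begin

text \<open>A natural-number form of \<open>distance\<close>, suited to induction and linear
  arithmetic; connectedness ensures that the minimum is attained for vertices of
  \<open>G\<close>.\<close>

definition depth :: "'a \<Rightarrow> 'a \<Rightarrow> nat" where
  "depth r v = (LEAST n. \<exists>p. awalk r p v \<and> length p = n)"

lemma ex_awalk:
  assumes "u \<in> verts G" "v \<in> verts G"
  shows "\<exists>p. awalk u p v"
  using connected assms reachable_awalk
  unfolding connected_def strongly_connected_def
  by (auto simp: reachable_mk_symmetric_eq[OF sym_arcs])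

lemma depth_le: "awalk r p v \<Longrightarrow> depth r v \<le> length p"
  unfolding depth_def by (rule Least_le) blast

lemma ex_shortest_awalk:
  assumes "r \<in> verts G" "v \<in> verts G"
  obtains p where "awalk r p v" "length p = depth r v"
proof -
  obtain p where "awalk r p v" using ex_awalk assms by blast
  then have "\<exists>p. awalk r p v \<and> length p = depth r v"
    unfolding depth_def by (rule_tac LeastI_ex) blast
  then show ?thesis using that by blast
qed

lemma distance_conv_depth:
  assumes "r \<in> verts G" "v \<in> verts G"
  shows "distance G r v = ereal (real (depth r v))"
proof -
  have cost: "awalk_cost (\<lambda>_. 1) p = real (length p)" for p
    by (induction p) auto
  obtain p where "awalk r p v" "length p = depth r v" using ex_shortest_awalk assms by blast
  then have "\<mu> (\<lambda>_. 1) r v = ereal (real (depth r v))"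
    unfolding \<mu>_def cost
    by (intro antisym INF_greatest) (auto intro: INF_lower2 dest: depth_le)
  then show ?thesis by (simp add: distance_def)
qed

lemma depth_self: "r \<in> verts G \<Longrightarrow> depth r r = 0"
  using depth_le[of r "[]" r] by (simp add: awalk_Nil_iff)

lemma depth_step:
  assumes "r \<in> verts G" "u \<rightarrow> v"
  shows "depth r v \<le> Suc (depth r u)"
proof -
  obtain p where p: "awalk r p u" "length p = depth r u"
    using ex_shortest_awalk assms dominates_in_verts by metis
  obtain e where "e \<in> arcs G" "tail G e = u" "head G e = v"
    using assms(2) by (auto simp: arcs_ends_conv)
  then have "awalk r (p @ [e]) v" using p assms dominates_in_verts by (auto simp: awalk_simps)
  from depth_le[OF this] show ?thesis using p(2) by simp
qed

text \<open>The next-to-last vertex of a shortest walk from the root is such a neighbour; positive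
  depth makes that walk nonempty.\<close>

lemma ex_lower_neighbour:
  assumes "r \<in> verts G" "v \<in> verts G" "0 < depth r v"
  obtains u where "v \<rightarrow> u" "depth r v = Suc (depth r u)"
proof -
  obtain p where p: "awalk r p v" "length p = depth r v" using ex_shortest_awalk assms by blast
  then obtain p' e where pe: "p = p' @ [e]" using assms(3) by (cases p rule: rev_cases) auto
  then have w: "awalk r p' (tail G e)" "e \<in> arcs G" "head G e = v"
    using p(1) by (auto simp: awalk_simps)
  then have "tail G e \<rightarrow> v" by (auto simp: arcs_ends_conv)
  then have "v \<rightarrow> tail G e" "depth r v \<le> Suc (depth r (tail G e))"
    using dominates_sym depth_step assms by blast+
  moreover have "Suc (depth r (tail G e)) \<le> depth r v" using depth_le[OF w(1)] p(2) pe by simp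
  ultimately show ?thesis using that by simp
qed

text \<open>Iterating \<open>ex_lower_neighbour\<close> leads to the root. The depth bound lets the
  walk avoid every vertex other than \<open>u\<close> that is at least as deep as
  \<open>u\<close>.\<close>

lemma ex_descending_awalk:
  assumes "r \<in> verts G" "u \<in> verts G"
  shows "\<exists>p. awalk u p r \<and> (\<forall>w \<in> set (awalk_verts u p). w = u \<or> depth r w < depth r u)"
  using assms(2)
proof (induction "depth r u" arbitrary: u rule: less_induct)
  case less
  show ?case
  proof (cases "depth r u = 0")
    case True
    then obtain p where "awalk r p u" "length p = 0"
      using ex_shortest_awalk assms(1) less.prems by metis
    then show ?thesis using assms(1) by (intro exI[of _ "[]"]) (auto simp: awalk_Nil_iff)
  next
    case False
    then obtain v where v: "u \<rightarrow> v" "depth r u = Suc (depth r v)"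
      using ex_lower_neighbour assms(1) less.prems by blast
    then obtain p where p: "awalk v p r"
      "\<forall>w \<in> set (awalk_verts v p). w = v \<or> depth r w < depth r v"
      using less.hyps[of v] dominates_in_verts by auto
    obtain e where "e \<in> arcs G" "tail G e = u" "head G e = v"
      using v(1) by (auto simp: arcs_ends_conv)
    then show ?thesis using p v(2) by (intro exI[of _ "e # p"]) (auto simp: awalk_simps)
  qed
qed

text \<open>
  The walks from \<open>u1\<close> and \<open>u2\<close> down to the root avoid \<open>v\<close>, so two such neighbours would
  lie on a cycle through \<open>v\<close>.
\<close>

lemma lower_neighbour_unique:
  assumes r: "r \<in> verts G" and u1: "v \<rightarrow> u1" "depth r u1 \<le> depth r v"
    and u2: "v \<rightarrow> u2" "depth r u2 \<le> depth r v"
  shows "u1 = u2"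
proof (rule ccontr)
  assume "u1 \<noteq> u2"
  obtain p1 where p1: "awalk u1 p1 r"
    "\<forall>w \<in> set (awalk_verts u1 p1). w = u1 \<or> depth r w < depth r u1"
    using ex_descending_awalk r u1 dominates_in_verts by metis
  obtain p2 where p2: "awalk u2 p2 r"
    "\<forall>w \<in> set (awalk_verts u2 p2). w = u2 \<or> depth r w < depth r u2"
    using ex_descending_awalk r u2 dominates_in_verts by metis
  obtain q2 where q2: "awalk r q2 u2" "set (awalk_verts r q2) = set (awalk_verts u2 p2)"
    using awalk_reverse p2 by blast
  \<comment> \<open>The start \<open>u1\<close> differs from \<open>v\<close> because there are no
    loops, and all other vertices are strictly less deep than \<open>u1\<close>, hence than
    \<open>v\<close>.\<close>
  have "v \<notin> set (awalk_verts u1 p1)" using p1 u1 dominates_neq by force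
  moreover have "v \<notin> set (awalk_verts r q2)" using p2 q2 u2 dominates_neq by force
  moreover have walk: "awalk u1 (p1 @ q2) u2" using p1 q2 by (auto intro: awalk_appendI)
  \<comment> \<open>The two walks may meet before the root; extracting a path removes repetitions
    without adding vertices, so \<open>v\<close> stays avoided.\<close>
  moreover define p where "p = awalk_to_apath (p1 @ q2)"
  moreover have "set (awalk_verts u1 p) \<subseteq> set (awalk_verts u1 (p1 @ q2))"
    using awalk_to_apath_subset[OF walk]
      set_awalk_verts[OF walk] set_awalk_verts[OF awalkI_apath[OF apath_awalk_to_apath[OF walk]]]
    unfolding p_def by auto
  ultimately have p: "awalk u1 p u2" "distinct (awalk_verts u1 p)" "v \<notin> set (awalk_verts u1 p)"
    using apath_awalk_to_apath[OF walk] set_awalk_verts_append[OF p1(1) q2(1)]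
    by (auto simp: apath_def)
  then have "p \<noteq> []" using \<open>u1 \<noteq> u2\<close> by (auto simp: awalk_Nil_iff)
  obtain e where e: "e \<in> arcs G" "tail G e = v" "head G e = u1"
    using u1(1) by (auto simp: arcs_ends_conv)
  obtain f where f: "f \<in> arcs G" "tail G f = u2" "head G f = v"
    using u2(1) dominates_sym by (fastforce simp: arcs_ends_conv)
  have "awalk u2 [f] v" using f by (auto simp: awalk_simps)
  then have pf: "awalk u1 (p @ [f]) v" using p(1) by (rule_tac awalk_appendI)
  then have "awalk v (e # p @ [f]) v" using e by (auto simp: awalk_simps)
  moreover have "distinct (awalk_verts u1 (p @ [f]))"
    using p awalk_verts_append[OF pf] f by auto
  ultimately have "cycle (e # p @ [f])" using e unfolding cycle_def by auto
  \<comment> \<open>As \<open>u1 \<noteq> u2\<close>, the path has at least one arc besides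
    \<open>e\<close> and \<open>f\<close>, so this is not an edge traversed back and forth.\<close>
  moreover have "3 \<le> length (e # p @ [f])" using \<open>p \<noteq> []\<close> by (cases p) auto
  ultimately show False using acyclic by blast
qed

lemma children_conv:
  assumes "r \<in> verts G" "v \<in> verts G"
  shows "children G r v = {w. v \<rightarrow> w \<and> depth r w = Suc (depth r v)}"
  using assms dominates_in_verts
  by (fastforce simp: children_def distance_conv_depth)

text \<open>By \<open>depth_step\<close>, a neighbour that is not a child is no deeper than
  \<open>v\<close>, so it equals \<open>u\<close> by \<open>lower_neighbour_unique\<close>, whose
  weak inequality also covers neighbours at equal depth.\<close>

lemma dominates_cases:
  assumes "r \<in> verts G" and u: "v \<rightarrow> u" "depth r v = Suc (depth r u)"
  shows "v \<rightarrow> w \<longleftrightarrow> w = u \<or> w \<in> children G r v"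
proof -
  have "w = u" if "v \<rightarrow> w" "depth r w \<noteq> Suc (depth r v)"
    using that lower_neighbour_unique[OF assms(1) that(1) _ u(1)] depth_step[OF assms(1) that(1)] u(2)
    by linarith
  then show ?thesis using u children_conv[OF assms(1)] dominates_in_verts by blast
qed

end

section \<open>Siblings and leaves in a complete binary tree\<close>

context complete_binary_tree
begin

lemma card_children: "v \<in> verts T \<Longrightarrow> depth r v < h \<Longrightarrow> card (children T r v) = 2"
  using two_children root by (simp add: distance_conv_depth)

lemma childD:
  assumes "w \<in> children T r v" "v \<in> verts T"
  shows "w \<in> verts T" "w \<rightarrow>\<^bsub>T\<^esub> v" "v \<rightarrow>\<^bsub>T\<^esub> w" "depth r w = Suc (depth r v)"
  using assms root children_conv dominates_in_verts dominates_sym by auto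

lemma ex_sibling:
  assumes "v \<in> verts T" "depth r v < h" "w \<in> children T r v"
  obtains w' where "w' \<noteq> w" "children T r v = {w, w'}"
proof -
  have "card (children T r v - {w}) = 1"
    using card_children[OF assms(1,2)] assms(3) by simp
  then obtain w' where "children T r v - {w} = {w'}" by (auto simp: card_1_singleton_iff)
  then show ?thesis using that assms(3) by blast
qed

text \<open>At depth \<open>h\<close> there are no children, so \<open>dominates_cases\<close>
  leaves the parent as the only neighbour.\<close>

lemma leaf_of_child:
  assumes "v \<in> verts T" "Suc (depth r v) = h" "w \<in> children T r v"
  shows "leaf_of w v"
proof -
  note w = childD[OF assms(3,1)]
  have "children T r w = {}" using leaves[of w] w assms(2) root by (simp add: distance_conv_depth)
  then show ?thesis using dominates_cases[OF root w(2,4)] by (simp add: leaf_of_def)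
qed

end

theorem corollary12:
  fixes T :: "('a, 'b) pre_digraph" and r l :: 'a and h :: nat
  assumes "h \<ge> 2"
    and "complete_binary_tree T r h"
    and "l \<in> verts T" and "distance T r l = ereal (real h)"
  shows "domination_number (pre_digraph.del_vert T l) = domination_number T
    \<and> dominion (pre_digraph.del_vert T l) = 2 * dominion T"
proof -
  interpret complete_binary_tree T r h by fact
  have "depth r l = h" using assms root by (simp add: distance_conv_depth)
  then obtain p where p: "l \<rightarrow>\<^bsub>T\<^esub> p" "h = Suc (depth r p)"
    using ex_lower_neighbour[OF root assms(3)] assms(1) by (metis less_le_trans pos2)
  have pV: "p \<in> verts T" using p dominates_in_verts by blast
  \<comment> \<open>Since \<open>h \<ge> 2\<close>, the vertex \<open>p\<close> at depth
    \<open>h - 1\<close> is not the root and has a parent.\<close>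
  obtain q where q: "p \<rightarrow>\<^bsub>T\<^esub> q" "depth r p = Suc (depth r q)"
    using ex_lower_neighbour[OF root pV] assms(1) p(2)
    by (metis Suc_1 Suc_le_mono less_eq_Suc_le One_nat_def)
  have qV: "q \<in> verts T" using q dominates_in_verts by blast
  have "l \<in> children T r p"
    using p \<open>depth r l = h\<close> children_conv[OF root pV] dominates_sym by simp
  then obtain l' where l': "l' \<noteq> l" "children T r p = {l, l'}"
    using ex_sibling[OF pV] p(2) by auto
  have "p \<in> children T r q" using q children_conv[OF root qV] dominates_sym by simp
  then obtain p' where p': "p' \<noteq> p" "children T r q = {p, p'}"
    using ex_sibling[OF qV] p(2) q(2) by auto
  note p'_child = childD[of p' q, OF _ qV]
  \<comment> \<open>The sibling \<open>p'\<close> also has depth \<open>h - 1\<close>, so its two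
    children are twin leaves.\<close>
  obtain m m' where m: "m \<noteq> m'" "children T r p' = {m, m'}"
    using card_children[of p'] p'_child p' p(2) q(2) by (auto simp: card_2_iff)
  have leaf_p: "leaf_of w p" if "w \<in> {l, l'}" for w
    using leaf_of_child[OF pV] p(2) l' that by simp
  have leaf_p': "leaf_of w p'" if "w \<in> {m, m'}" for w
    using leaf_of_child[of p'] p'_child p' p(2) q(2) m that by simp
  have nbrs: "u \<in> {l, l', q}" if "p \<rightarrow>\<^bsub>T\<^esub> u" for u
    using dominates_cases[OF root q] that l' by auto
  show ?thesis
    using domination_del_twin_leaf[OF leaf_p leaf_p l'(1)[symmetric] nbrs _ p'(1) leaf_p' leaf_p' m(1)]
      p'_child p' by auto
qed

end
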